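(* Let $p\in[1,2]$ and let $\kappa>1$ be a constant. If $(\mathcal{S},f)$ is a $(k,\sqrt{\kappa})$-sketching family for the $1\to p$ norm of $n\times n$ real matrices, then $k=\Omega(n)$.
   Context: $\|A\|_{q\to p}=\sup_{x\ne0}\frac{\|Ax\|_p}{\|x\|_q}$. A $(k,\alpha)$-sketching family for the $q\to p$ norm is a pair $(\mathcal{S},f)$ where $\mathcal{S}$ is a distribution over linear maps $L:\mathbb{R}^{n\times n}\to\mathbb{R}^k$ and $f:\mathbb{R}^k\to\mathbb{R}$, such that for every $A$, $\Pr_{L\sim\mathcal{S}}\big[f(L(A))\in(\tfrac1\alpha\|A\|_{q\to p},\,\alpha\|A\|_{q\to p})\big]\ge \frac56$. *)

theory Defs
  imports "HOL-Probability.Probability" "Jordan_Normal_Form.Matrix"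
begin

text \<open>
  The dimension \<open>n\<close> varies inside the statement, so \<open>\<real>\<^sup>k\<close> is \<^term>\<open>carrier_vec k :: real vec set\<close>
  and \<open>\<real>\<^sup>n\<^sup>\<times>\<^sup>n\<close> is \<^term>\<open>carrier_mat n n :: real mat set\<close>. The infix \<open>$\<close> is reserved for vectors of
  this kind.
\<close>

unbundle no vec_syntax

definition vec_lp_norm :: "real \<Rightarrow> real vec \<Rightarrow> real" where
  "vec_lp_norm p v = (\<Sum>i<dim_vec v. \<bar>v $ i\<bar> powr p) powr (1 / p)"

text \<open>
  The norm \<open>\<parallel>A\<parallel>\<^bsub>q\<rightarrow>p\<^esub>\<close>, for real exponents \<open>p, q \<ge> 1\<close> and a matrix with at least one column;
  otherwise the supremum is not meaningful.
\<close>

definition operator_lp_norm :: "real \<Rightarrow> real \<Rightarrow> real mat \<Rightarrow> real" where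
  "operator_lp_norm q p A =
     (SUP x \<in> {x \<in> carrier_vec (dim_col A). x \<noteq> 0\<^sub>v (dim_col A)}.
        vec_lp_norm p (A *\<^sub>v x) / vec_lp_norm q x)"

text \<open>
  There is no topology on \<^typ>\<open>real vec\<close>; the Borel \<open>\<sigma>\<close>-algebra of \<open>\<real>\<^sup>k\<close> is generated by the
  coordinates.
\<close>

definition vec_borel :: "nat \<Rightarrow> real vec measure" where
  "vec_borel k =
     vimage_algebra (carrier_vec k) (\<lambda>v. \<lambda>i\<in>{..<k}. v $ i) (\<Pi>\<^sub>M i\<in>{..<k}. borel)"

text \<open>Only the values of \<open>L\<close> on \<open>n \<times> n\<close> matrices are constrained.\<close>

definition linear_sketch :: "nat \<Rightarrow> nat \<Rightarrow> (real mat \<Rightarrow> real vec) \<Rightarrow> bool" where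
  "linear_sketch n k L \<longleftrightarrow>
     (\<forall>A \<in> carrier_mat n n. L A \<in> carrier_vec k) \<and>
     (\<forall>A \<in> carrier_mat n n. \<forall>B \<in> carrier_mat n n. L (A + B) = L A + L B) \<and>
     (\<forall>c. \<forall>A \<in> carrier_mat n n. L (c \<cdot>\<^sub>m A) = c \<cdot>\<^sub>v L A)"

text \<open>
  A \<open>(k, \<alpha>)\<close>-sketching family for the \<open>q \<rightarrow> p\<close> norm of \<open>n \<times> n\<close> matrices. A distribution over linear
  maps is a probability measure \<open>S\<close> on a set of linear maps for which every evaluation \<open>L \<mapsto> L A\<close> is
  a random vector. The estimator \<open>f\<close> is Borel measurable; without this, non-measurable
  estimators can (assuming the continuum hypothesis) succeed with \<open>k = 1\<close>.
  The zero matrix is excluded because the interval \<open>(\<parallel>A\<parallel>/\<alpha>, \<alpha>\<parallel>A\<parallel>)\<close> is empty for \<open>A = 0\<close>, so that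
  including it would rule out every sketching family.
\<close>

definition sketching_family ::
  "nat \<Rightarrow> real \<Rightarrow> real \<Rightarrow> nat \<Rightarrow> real \<Rightarrow> (real mat \<Rightarrow> real vec) measure \<Rightarrow> (real vec \<Rightarrow> real) \<Rightarrow> bool"
where
  "sketching_family n q p k \<alpha> S f \<longleftrightarrow>
     prob_space S \<and>
     (\<forall>L \<in> space S. linear_sketch n k L) \<and>
     (\<forall>A \<in> carrier_mat n n. (\<lambda>L. L A) \<in> S \<rightarrow>\<^sub>M vec_borel k) \<and>
     f \<in> borel_measurable (vec_borel k) \<and>
     (\<forall>A \<in> carrier_mat n n. A \<noteq> 0\<^sub>m n n \<longrightarrow>
        measure S {L \<in> space S.
          f (L A) \<in> {1 / \<alpha> * operator_lp_norm q p A <..< \<alpha> * operator_lp_norm q p A}} \<ge> 5 / 6)"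

end

(*
  On diagonal matrices diag(x) the norm is max |x_i|, for every p. Let x be random in the cube (0,1)^n,
  with product density G^2 where G is a product of Lipschitz bumps, and let j be a random index. Then
  diag(x) has norm at most 1 and diag(x + kappa e_j) has norm at least kappa, so f must tell them apart
  at the threshold sqrt kappa. If P is the orthogonal projection onto the row space of L restricted to
  diagonal matrices, L does not see the difference between the shifts kappa e_j and kappa P e_j. The
  latter changes the distribution of x only by O(kappa^2 |P e_j|^2), as G has a square integrable
  derivative, and the sum of |P e_j|^2 over j is the trace of P, which is at most k. Averaging over j
  gives 5/6 + 5/6 <= 3/2 + O(kappa^2 k / n).
*)

theory Submission
  imports Defs
begin

section \<open>A bump with compact support and its product\<close>

text \<open>A probability amplitude: its square is the density of one coordinate. Clamping to the
  unit interval cuts off the support and keeps the function Lipschitz, and \<open>sqrt 30\<close>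
  normalises, since the integral of s^2 (1 - s)^2 over [0,1] is 1/30.\<close>

definition bump :: "real \<Rightarrow> real" where
  "bump s = (let c = max 0 (min 1 s) in sqrt 30 * (c * (1 - c)))"

lemma bump_nonneg: "0 \<le> bump s"
  by (auto simp: bump_def Let_def)

lemma bump_eq_0: "s \<notin> {0<..<1} \<Longrightarrow> bump s = 0"
  by (auto simp: bump_def Let_def max_def min_def)

lemma borel_measurable_bump [measurable]: "bump \<in> borel_measurable borel"
  unfolding bump_def Let_def by measurable

text \<open>Clamping does not increase distances, and c (1 - c) - d (1 - d) = (c - d)(1 - c - d),
  whose second factor is at most 1 in absolute value on the unit square.\<close>

lemma bump_lipschitz: "\<bar>bump s - bump t\<bar> \<le> sqrt 30 * \<bar>s - t\<bar>"
proof -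
  define c d where "c = max 0 (min 1 s)" and "d = max 0 (min 1 t)"
  have cd: "0 \<le> c" "c \<le> 1" "0 \<le> d" "d \<le> 1" "\<bar>c - d\<bar> \<le> \<bar>s - t\<bar>"
    by (auto simp: c_def d_def max_def min_def)
  have "bump s - bump t = sqrt 30 * ((c - d) * (1 - c - d))"
    by (simp add: bump_def Let_def c_def[symmetric] d_def[symmetric] algebra_simps)
  moreover have "\<bar>c - d\<bar> * \<bar>1 - c - d\<bar> \<le> \<bar>s - t\<bar> * 1"
    using cd by (intro mult_mono) auto
  ultimately show ?thesis
    by (simp add: abs_mult)
qed

lemma has_bochner_integral_bump_square: "has_bochner_integral lborel (\<lambda>s. (bump s)\<^sup>2) 1"
proof -
  \<comment> \<open>The antiderivative of 30 s^2 (1 - s)^2; here F 1 - F 0 = 30 (1/3 - 1/2 + 1/5) =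
    1.\<close>
  define F where "F s = 30 * (s ^ 3 / 3 - s ^ 4 / 2 + s ^ 5 / 5)" for s :: real
  have "has_bochner_integral lborel (\<lambda>s. 30 * (s * (1 - s))\<^sup>2 * indicator {0..1} s) (F 1 - F 0)"
  proof (rule has_bochner_integral_FTC_Icc_nonneg)
    show "DERIV F s :> 30 * (s * (1 - s))\<^sup>2" for s
      unfolding F_def by (auto intro!: derivative_eq_intros simp: power2_eq_square power3_eq_cube field_simps eval_nat_numeral)
  qed auto
  moreover have "(bump s)\<^sup>2 = 30 * (s * (1 - s))\<^sup>2 * indicator {0..1} s" for s
    by (auto simp: bump_def Let_def indicator_def power_mult_distrib max_def min_def)
  ultimately show ?thesis
    by (simp add: F_def)
qed

lemma has_bochner_integral_bump_square_shift:
  "has_bochner_integral lborel (\<lambda>s. (bump (s - t))\<^sup>2) 1"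
  using has_bochner_integral_bump_square
    lborel_has_bochner_integral_real_affine_iff[of 1 "\<lambda>s. (bump s)\<^sup>2" 1 "-t"]
  by simp

text \<open>The overlap is the Hellinger affinity of the density and its translate. Expanding the
  square, the squared L2 distance of the two amplitudes is 2 minus twice the overlap, so the
  Lipschitz bound gives a loss quadratic in \<open>t\<close>.\<close>

lemma
  shows integrable_bump_overlap: "integrable lborel (\<lambda>s. bump s * bump (s - t))"
    and bump_overlap_nonneg: "0 \<le> (\<integral>s. bump s * bump (s - t) \<partial>lborel)"
    and bump_overlap_le_1: "(\<integral>s. bump s * bump (s - t) \<partial>lborel) \<le> 1"
    and bump_overlap_ge: "1 - 30 * t\<^sup>2 \<le> (\<integral>s. bump s * bump (s - t) \<partial>lborel)"
proof -
  have sq: "integrable lborel (\<lambda>s. (bump s)\<^sup>2)" "(\<integral>s. (bump s)\<^sup>2 \<partial>lborel) = 1"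
    "integrable lborel (\<lambda>s. (bump (s - t))\<^sup>2)" "(\<integral>s. (bump (s - t))\<^sup>2 \<partial>lborel) = 1"
    using has_bochner_integral_bump_square has_bochner_integral_bump_square_shift[of t]
    by (auto simp: has_bochner_integral_iff)
  show cross: "integrable lborel (\<lambda>s. bump s * bump (s - t))"
  proof (rule Bochner_Integration.integrable_bound)
    show "integrable lborel (\<lambda>s. (bump s)\<^sup>2 + (bump (s - t))\<^sup>2)"
      using sq by simp
    show "AE s in lborel. norm (bump s * bump (s - t)) \<le> norm ((bump s)\<^sup>2 + (bump (s - t))\<^sup>2)"
    proof (rule AE_I2)
      fix s
      have "2 * (bump s * bump (s - t)) \<le> (bump s)\<^sup>2 + (bump (s - t))\<^sup>2"
        using sum_squares_bound[of "bump s" "bump (s - t)"] by (simp add: mult.assoc)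
      moreover have "0 \<le> bump s * bump (s - t)"
        by (simp add: bump_nonneg)
      ultimately show "norm (bump s * bump (s - t)) \<le> norm ((bump s)\<^sup>2 + (bump (s - t))\<^sup>2)"
        by simp
    qed
  qed simp
  have eq: "(\<integral>s. (bump s - bump (s - t))\<^sup>2 \<partial>lborel) = 2 - 2 * (\<integral>s. bump s * bump (s - t) \<partial>lborel)"
    using sq cross by (simp add: power2_diff mult.assoc)
  show "0 \<le> (\<integral>s. bump s * bump (s - t) \<partial>lborel)"
    by (intro integral_nonneg_AE) (simp add: bump_nonneg)
  have "0 \<le> (\<integral>s. (bump s - bump (s - t))\<^sup>2 \<partial>lborel)"
    by (intro integral_nonneg_AE) simp
  then show "(\<integral>s. bump s * bump (s - t) \<partial>lborel) \<le> 1"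
    using eq by simp
  \<comment> \<open>The difference lives on the union of two unit intervals. Adding their indicators
    gives integral 2 whether or not they intersect, hence the bound 60 t^2 below.\<close>
  have pt: "(bump s - bump (s - t))\<^sup>2 \<le> 30 * t\<^sup>2 * (indicator {0..1} s + indicator {t..1 + t} s)" for s
  proof (cases "s \<in> {0..1} \<or> s \<in> {t..1 + t}")
    case True
    have "(bump s - bump (s - t))\<^sup>2 \<le> (sqrt 30 * \<bar>t\<bar>)\<^sup>2"
      using bump_lipschitz[of s "s - t"] by (intro abs_le_square_iff[THEN iffD1]) simp
    also have "\<dots> = 30 * t\<^sup>2"
      by (simp add: power_mult_distrib)
    also have "\<dots> \<le> 30 * t\<^sup>2 * (indicator {0..1} s + indicator {t..1 + t} s)"
      using True by (auto simp: indicator_def)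
    finally show ?thesis .
  next
    case False
    then have "bump s = 0" "bump (s - t) = 0"
      by (auto intro!: bump_eq_0)
    then show ?thesis
      by simp
  qed
  have "(\<integral>s. (bump s - bump (s - t))\<^sup>2 \<partial>lborel)
      \<le> (\<integral>s. 30 * t\<^sup>2 * (indicator {0..1} s + indicator {t..1 + t} s) \<partial>lborel)"
    using sq cross pt by (intro integral_mono) (auto simp: power2_diff mult.assoc)
  also have "\<dots> = 60 * t\<^sup>2"
    by (simp add: Bochner_Integration.integral_add)
  finally show "1 - 30 * t\<^sup>2 \<le> (\<integral>s. bump s * bump (s - t) \<partial>lborel)"
    using eq by simp
qed

text \<open>The Weierstrass product inequality; the induction step rests on (1 - a)(1 - b) >=
  0.\<close>

lemma prod_ge_1_minus_sum:
  fixes h :: "'a \<Rightarrow> real"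
  assumes "finite I" "\<And>i. i \<in> I \<Longrightarrow> 0 \<le> h i" "\<And>i. i \<in> I \<Longrightarrow> h i \<le> 1"
  shows "1 - (\<Sum>i\<in>I. 1 - h i) \<le> (\<Prod>i\<in>I. h i)"
  using assms
proof (induction I rule: finite_induct)
  case (insert i I)
  have "prod h I \<le> 1"
    using insert.prems by (intro prod_le_1) auto
  then have "0 \<le> (1 - h i) * (1 - prod h I)"
    using insert.prems by (intro mult_nonneg_nonneg) auto
  then have "h i + prod h I - 1 \<le> h i * prod h I"
    by (simp add: algebra_simps)
  moreover have "1 - (\<Sum>i\<in>I. 1 - h i) \<le> prod h I"
    using insert by auto
  ultimately show ?case
    using insert.hyps by simp
qed simp

section \<open>Products of bumps on R^n and their translates\<close>

abbreviation lborel_n :: "nat \<Rightarrow> (nat \<Rightarrow> real) measure" where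
  "lborel_n n \<equiv> \<Pi>\<^sub>M i\<in>{..<n}. lborel"

definition bump_n :: "nat \<Rightarrow> (nat \<Rightarrow> real) \<Rightarrow> real" where
  "bump_n n x = (\<Prod>i<n. bump (x i))"

lemma borel_measurable_bump_n [measurable]: "bump_n n \<in> borel_measurable (lborel_n n)"
  unfolding bump_n_def by measurable

text \<open>The shifted function need not be extensional, so it may lie outside the product space;
  \<open>bump_n\<close> only reads the coordinates below \<open>n\<close>.\<close>

lemma borel_measurable_bump_n_shift [measurable]:
  "(\<lambda>x. bump_n n (\<lambda>i. x i - w i)) \<in> borel_measurable (lborel_n n)"
  unfolding bump_n_def by measurable

lemma bump_n_nonneg: "0 \<le> bump_n n x"
  unfolding bump_n_def by (intro prod_nonneg) (simp add: bump_nonneg)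

lemma bump_n_support: "bump_n n x \<noteq> 0 \<Longrightarrow> i < n \<Longrightarrow> x i \<in> {0<..<1}"
  unfolding bump_n_def using bump_eq_0 by (metis finite_lessThan lessThan_iff prod_zero)

lemma has_bochner_integral_bump_n_square:
  "has_bochner_integral (lborel_n n) (\<lambda>x. (bump_n n (\<lambda>i. x i - w i))\<^sup>2) 1"
proof -
  interpret product_sigma_finite "\<lambda>_::nat. lborel :: real measure"
    by standard
  have "integrable lborel (\<lambda>s. (bump (s - t))\<^sup>2)" "(\<integral>s. (bump (s - t))\<^sup>2 \<partial>lborel) = 1" for t
    using has_bochner_integral_bump_square_shift[of t] by (auto simp: has_bochner_integral_iff)
  then show ?thesis
    using product_integrable_prod[of "{..<n}" "\<lambda>i s. (bump (s - w i))\<^sup>2"]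
      product_integral_prod[of "{..<n}" "\<lambda>i s. (bump (s - w i))\<^sup>2"]
    by (simp add: has_bochner_integral_iff bump_n_def prod_power_distrib)
qed

text \<open>The affinity of product amplitudes factors over the coordinates. The product inequality
  turns the one-dimensional losses into their sum, which is 30 times the squared Euclidean length of
  the shift.\<close>

lemma
  shows integrable_bump_n_overlap:
      "integrable (lborel_n n) (\<lambda>x. bump_n n x * bump_n n (\<lambda>i. x i - w i))"
    and bump_n_overlap_ge:
      "1 - 30 * (\<Sum>i<n. (w i)\<^sup>2) \<le> (\<integral>x. bump_n n x * bump_n n (\<lambda>i. x i - w i) \<partial>lborel_n n)"
proof -
  interpret product_sigma_finite "\<lambda>_::nat. lborel :: real measure"
    by standard
  show "integrable (lborel_n n) (\<lambda>x. bump_n n x * bump_n n (\<lambda>i. x i - w i))"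
    using product_integrable_prod[of "{..<n}" "\<lambda>i s. bump s * bump (s - w i)"]
    by (simp add: bump_n_def prod.distrib integrable_bump_overlap)
  let ?h = "\<lambda>i. \<integral>s. bump s * bump (s - w i) \<partial>lborel"
  have "30 * (\<Sum>i<n. (w i)\<^sup>2) \<ge> (\<Sum>i<n. 1 - ?h i)"
    unfolding sum_distrib_left using bump_overlap_ge by (intro sum_mono) (simp add: diff_le_eq add.commute)
  moreover have "1 - (\<Sum>i<n. 1 - ?h i) \<le> (\<Prod>i<n. ?h i)"
    by (intro prod_ge_1_minus_sum) (auto simp: bump_overlap_nonneg bump_overlap_le_1)
  moreover have "(\<integral>x. bump_n n x * bump_n n (\<lambda>i. x i - w i) \<partial>lborel_n n) = (\<Prod>i<n. ?h i)"
    using product_integral_prod[of "{..<n}" "\<lambda>i s. bump s * bump (s - w i)"]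
    by (simp add: bump_n_def prod.distrib integrable_bump_overlap)
  ultimately show "1 - 30 * (\<Sum>i<n. (w i)\<^sup>2) \<le> (\<integral>x. bump_n n x * bump_n n (\<lambda>i. x i - w i) \<partial>lborel_n n)"
    by simp
qed

lemma measurable_shift [measurable]:
  "(\<lambda>x. \<lambda>i\<in>{..<n}. x i + w i) \<in> lborel_n n \<rightarrow>\<^sub>M lborel_n n"
  by (rule measurable_restrict) measurable

text \<open>Translation invariance of Lebesgue measure on R^n, checked on boxes: the preimage of a
  box is a box with translated sides.\<close>

lemma distr_lborel_n_shift:
  "distr (lborel_n n) (lborel_n n) (\<lambda>x. \<lambda>i\<in>{..<n}. x i + w i) = lborel_n n"
proof -
  interpret product_sigma_finite "\<lambda>_::nat. lborel :: real measure"
    by standard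
  show ?thesis
  proof (rule PiM_eqI)
    fix A :: "nat \<Rightarrow> real set"
    assume A: "\<And>i. i \<in> {..<n} \<Longrightarrow> A i \<in> sets lborel"
    have vim: "(\<lambda>s. s + t) -` B \<in> sets lborel" "emeasure lborel ((\<lambda>s. s + t) -` B) = emeasure lborel B"
      if "B \<in> sets lborel" for B and t :: real
    proof -
      show "(\<lambda>s. s + t) -` B \<in> sets lborel"
        using measurable_sets[of "\<lambda>s. s + t" borel borel B] that by simp
      have "emeasure lborel B = emeasure (distr lborel borel ((+) t)) B"
        by (simp add: lborel_distr_plus)
      then show "emeasure lborel ((\<lambda>s. s + t) -` B) = emeasure lborel B"
        using that by (simp add: emeasure_distr add.commute[of _ t])
    qed
    have "(\<lambda>x. \<lambda>i\<in>{..<n}. x i + w i) -` (Pi\<^sub>E {..<n} A) \<inter> space (lborel_n n)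
        = (\<Pi>\<^sub>E i\<in>{..<n}. (\<lambda>s. s + w i) -` A i)"
      by (auto simp: space_PiM PiE_iff)
    then have "emeasure (distr (lborel_n n) (lborel_n n) (\<lambda>x. \<lambda>i\<in>{..<n}. x i + w i)) (Pi\<^sub>E {..<n} A)
        = emeasure (lborel_n n) (\<Pi>\<^sub>E i\<in>{..<n}. (\<lambda>s. s + w i) -` A i)"
      using A by (subst emeasure_distr) (auto intro!: sets_PiM_I_finite)
    also have "\<dots> = (\<Prod>i<n. emeasure lborel (A i))"
      using A vim by (subst emeasure_PiM) auto
    finally show "emeasure (distr (lborel_n n) (lborel_n n) (\<lambda>x. \<lambda>i\<in>{..<n}. x i + w i)) (Pi\<^sub>E {..<n} A)
        = (\<Prod>i\<in>{..<n}. emeasure lborel (A i))" .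
  qed auto
qed

lemma integral_lborel_n_shift:
  fixes \<phi> :: "(nat \<Rightarrow> real) \<Rightarrow> real"
  assumes [measurable]: "\<phi> \<in> borel_measurable (lborel_n n)"
  shows "(\<integral>x. \<phi> (\<lambda>i\<in>{..<n}. x i + w i) \<partial>lborel_n n) = (\<integral>x. \<phi> x \<partial>lborel_n n)"
  by (subst (2) distr_lborel_n_shift[of n w, symmetric]) (simp add: integral_distr)

section \<open>The noise distribution\<close>

definition noise :: "nat \<Rightarrow> (nat \<Rightarrow> real) measure" where
  "noise n = density (lborel_n n) (\<lambda>x. ennreal ((bump_n n x)\<^sup>2))"

lemma sets_noise [measurable_cong, simp]: "sets (noise n) = sets (lborel_n n)"
  by (simp add: noise_def)

lemma space_noise [simp]: "space (noise n) = space (lborel_n n)"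
  by (simp add: noise_def)

lemma measure_noise:
  assumes "A \<in> sets (lborel_n n)"
  shows "measure (noise n) A = (\<integral>x. (bump_n n x)\<^sup>2 * indicator A x \<partial>lborel_n n)"
    and "emeasure (noise n) A = ennreal (\<integral>x. (bump_n n x)\<^sup>2 * indicator A x \<partial>lborel_n n)"
proof -
  have "integrable (lborel_n n) (\<lambda>x. (bump_n n x)\<^sup>2)"
    using has_bochner_integral_bump_n_square[of n "\<lambda>_. 0"] by (auto simp: has_bochner_integral_iff)
  then have "integrable (lborel_n n) (\<lambda>x. (bump_n n x)\<^sup>2 * indicator A x)"
    using assms by (rule integrable_real_mult_indicator[rotated])
  then show "emeasure (noise n) A = ennreal (\<integral>x. (bump_n n x)\<^sup>2 * indicator A x \<partial>lborel_n n)"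
    using assms unfolding noise_def
    by (subst emeasure_density; simp?; subst nn_integral_eq_integral[symmetric])
       (auto simp: ennreal_mult' intro!: nn_integral_cong split: split_indicator)
  then show "measure (noise n) A = (\<integral>x. (bump_n n x)\<^sup>2 * indicator A x \<partial>lborel_n n)"
    by (simp add: measure_def integral_nonneg_AE)
qed

lemma prob_space_noise: "prob_space (noise n)"
proof (rule prob_spaceI)
  have "(\<integral>x. (bump_n n x)\<^sup>2 * indicator (space (lborel_n n)) x \<partial>lborel_n n) = (\<integral>x. (bump_n n x)\<^sup>2 \<partial>lborel_n n)"
    by (rule Bochner_Integration.integral_cong) auto
  also have "\<dots> = 1"
    using has_bochner_integral_bump_n_square[of n "\<lambda>_. 0"] by (auto simp: has_bochner_integral_iff)
  finally show "emeasure (noise n) (space (noise n)) = 1"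
    using measure_noise(2)[of "space (lborel_n n)" n] by simp
qed

lemma AE_noise: "AE x in noise n. \<forall>i<n. x i \<in> {0<..<1}"
  unfolding noise_def by (subst AE_density) (use bump_n_support in fastforce)+

text \<open>
  The best test between two densities \<open>a\<^sup>2\<close> and \<open>b\<^sup>2\<close> succeeds on both sides with total probability
  \<open>\<integral> max a\<^sup>2 b\<^sup>2\<close>, which \<open>max a\<^sup>2 b\<^sup>2 \<le> 5/4 (a\<^sup>2 + b\<^sup>2) - a b\<close> bounds in terms of the overlap \<open>\<integral> a b\<close>.
\<close>

lemma noise_test:
  assumes T[measurable]: "Measurable.pred (lborel_n n) T"
  shows "measure (noise n) {x \<in> space (lborel_n n). T x}
      + measure (noise n) {x \<in> space (lborel_n n). \<not> T (\<lambda>i\<in>{..<n}. x i + w i)}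
      \<le> 3 / 2 + 30 * (\<Sum>i<n. (w i)\<^sup>2)"
proof -
  let ?N = "lborel_n n"
  let ?g = "bump_n n" and ?g' = "\<lambda>x. bump_n n (\<lambda>i. x i - w i)"
  let ?A = "{x \<in> space ?N. T x}" and ?B = "{x \<in> space ?N. \<not> T x}"
  have int: "integrable ?N (\<lambda>x. (?g x)\<^sup>2)" "integrable ?N (\<lambda>x. (?g' x)\<^sup>2)"
    "(\<integral>x. (?g x)\<^sup>2 \<partial>?N) = 1" "(\<integral>x. (?g' x)\<^sup>2 \<partial>?N) = 1"
    using has_bochner_integral_bump_n_square[of n "\<lambda>_. 0"] has_bochner_integral_bump_n_square[of n w]
    by (auto simp: has_bochner_integral_iff)
  have intA: "integrable ?N (\<lambda>x. (?g x)\<^sup>2 * indicator ?A x)"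
    by (intro integrable_real_mult_indicator int) measurable
  have intB: "integrable ?N (\<lambda>x. (?g' x)\<^sup>2 * indicator ?B x)"
    by (intro integrable_real_mult_indicator int) measurable
  have "measure (noise n) {x \<in> space ?N. \<not> T (\<lambda>i\<in>{..<n}. x i + w i)}
      = (\<integral>x. (?g x)\<^sup>2 * indicator {x \<in> space ?N. \<not> T (\<lambda>i\<in>{..<n}. x i + w i)} x \<partial>?N)"
    by (rule measure_noise) measurable
  \<comment> \<open>Substituting y = x + w moves the shift from the test to the density, so that
    both errors become integrals over complementary sets.\<close>
  also have "\<dots> = (\<integral>x. (\<lambda>y. (?g' y)\<^sup>2 * indicator ?B y) (\<lambda>i\<in>{..<n}. x i + w i) \<partial>?N)"
    by (intro Bochner_Integration.integral_cong refl)
       (auto simp: bump_n_def indicator_def space_PiM)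
  also have "\<dots> = (\<integral>x. (?g' x)\<^sup>2 * indicator ?B x \<partial>?N)"
    by (rule integral_lborel_n_shift) measurable
  finally have B: "measure (noise n) {x \<in> space ?N. \<not> T (\<lambda>i\<in>{..<n}. x i + w i)} = \<dots>" .
  have A: "measure (noise n) ?A = (\<integral>x. (?g x)\<^sup>2 * indicator ?A x \<partial>?N)"
    by (rule measure_noise) measurable
  have pt: "a\<^sup>2 \<le> 5 / 4 * (a\<^sup>2 + b\<^sup>2) - a * b" for a b :: real
  proof -
    have "0 \<le> (a / 2 - b)\<^sup>2 + b\<^sup>2 / 4"
      by simp
    then show ?thesis
      by (simp add: power2_diff power_divide algebra_simps)
  qed
  have "(\<integral>x. (?g x)\<^sup>2 * indicator ?A x \<partial>?N) + (\<integral>x. (?g' x)\<^sup>2 * indicator ?B x \<partial>?N)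
      = (\<integral>x. (?g x)\<^sup>2 * indicator ?A x + (?g' x)\<^sup>2 * indicator ?B x \<partial>?N)"
    using intA intB by simp
  also have "\<dots> \<le> (\<integral>x. 5 / 4 * ((?g x)\<^sup>2 + (?g' x)\<^sup>2) - ?g x * ?g' x \<partial>?N)"
  proof (rule integral_mono)
    show "integrable ?N (\<lambda>x. 5 / 4 * ((?g x)\<^sup>2 + (?g' x)\<^sup>2) - ?g x * ?g' x)"
      using int integrable_bump_n_overlap by simp
    fix x
    show "(?g x)\<^sup>2 * indicator ?A x + (?g' x)\<^sup>2 * indicator ?B x
        \<le> 5 / 4 * ((?g x)\<^sup>2 + (?g' x)\<^sup>2) - ?g x * ?g' x" if "x \<in> space ?N"
      \<comment> \<open>Exactly one of the two indicators is 1 at \<open>x\<close>, so one of the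
        two orders of \<open>pt\<close> applies.\<close>
      using that pt[of "?g x" "?g' x"] pt[of "?g' x" "?g x"]
      by (auto simp: indicator_def algebra_simps)
  qed (use intA intB in simp)
  \<comment> \<open>Both densities have mass 1, so 5/4 of their sum integrates to 5/2; an overlap
    close to 1 then leaves about 3/2.\<close>
  also have "\<dots> = 5 / 2 - (\<integral>x. ?g x * ?g' x \<partial>?N)"
    using int integrable_bump_n_overlap[where n = n and w = w] by simp
  also have "\<dots> \<le> 3 / 2 + 30 * (\<Sum>i<n. (w i)\<^sup>2)"
    using bump_n_overlap_ge[where n = n and w = w] by simp
  finally show ?thesis
    by (simp add: A B)
qed

section \<open>Projection onto the span of finitely many vectors\<close>

text \<open>\<open>P\<close> is the matrix of the orthogonal projection onto the span of the
  \<open>k\<close> vectors, built by Gram-Schmidt. Each vector raises the trace by 1 or, if it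
  depends on the earlier ones, by 0.\<close>

lemma exists_projection_fixing:
  fixes \<rho> :: "nat \<Rightarrow> nat \<Rightarrow> real"
  shows "\<exists>P :: nat \<Rightarrow> nat \<Rightarrow> real. (\<forall>i j. P i j = P j i) \<and> (\<forall>i j. (\<Sum>m<n. P i m * P m j) = P i j)
      \<and> (\<Sum>i<n. P i i) \<le> real k \<and> (\<forall>r<k. \<forall>i<n. (\<Sum>m<n. P i m * \<rho> r m) = \<rho> r i)"
proof (induction k)
  case 0
  show ?case
    by (rule exI[of _ "\<lambda>_ _. 0"]) simp
next
  case (Suc k)
  then obtain P where sym: "\<And>i j. P i j = P j i"
    and idem: "\<And>i j. (\<Sum>m<n. P i m * P m j) = P i j"
    and tr: "(\<Sum>i<n. P i i) \<le> real k"
    and fixed: "\<And>r i. r < k \<Longrightarrow> i < n \<Longrightarrow> (\<Sum>m<n. P i m * \<rho> r m) = \<rho> r i"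
    by blast
  \<comment> \<open>The component of the new vector orthogonal to the range of \<open>P\<close>,
    with squared length \<open>s\<close>.\<close>
  define v where "v i = \<rho> k i - (\<Sum>m<n. P i m * \<rho> k m)" for i
  define s where "s = (\<Sum>i<n. (v i)\<^sup>2)"
  have Pv: "(\<Sum>m<n. P i m * v m) = 0" for i
  proof -
    have "(\<Sum>m<n. P i m * (\<Sum>l<n. P m l * \<rho> k l)) = (\<Sum>l<n. (\<Sum>m<n. P i m * P m l) * \<rho> k l)"
      by (subst sum_distrib_left, subst sum.swap) (simp add: sum_distrib_right mult.assoc)
    then show ?thesis
      by (simp add: v_def right_diff_distrib sum_subtractf idem)
  qed
  have vP: "(\<Sum>m<n. v m * P m j) = 0" for j
    using Pv[of j] by (simp add: mult.commute sym[of _ j])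
  show ?case
  proof (cases "s = 0")
    case True
    then have "v i = 0" if "i < n" for i
      using that by (simp add: s_def sum_nonneg_eq_0_iff)
    then have "(\<Sum>m<n. P i m * \<rho> k m) = \<rho> k i" if "i < n" for i
      using that by (simp add: v_def)
    then show ?thesis
      using sym idem tr fixed by (intro exI[of _ P]) (auto simp: less_Suc_eq)
  next
    case False
    \<comment> \<open>Adds the rank-one projection onto the line of \<open>v\<close>. The cross
      terms in its square vanish by \<open>Pv\<close> and \<open>vP\<close>, and its trace exceeds
      that of \<open>P\<close> by s / s = 1.\<close>
    define Q where "Q i j = P i j + v i * v j / s" for i j
    have "(\<Sum>m<n. Q i m * Q m j) = Q i j" for i j
    proof -
      have "(\<Sum>m<n. Q i m * Q m j) = (\<Sum>m<n. P i m * P m j) + (\<Sum>m<n. P i m * v m) * v j / s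
          + v i * (\<Sum>m<n. v m * P m j) / s + v i * v j * s / (s * s)"
        by (simp add: Q_def s_def[unfolded power2_eq_square] sum_distrib_left sum_distrib_right
              sum_divide_distrib sum.distrib[symmetric] algebra_simps power2_eq_square)
      then show ?thesis
        using False by (simp add: idem Pv vP Q_def)
    qed
    moreover have "(\<Sum>i<n. Q i i) \<le> real (Suc k)"
    proof -
      have "(\<Sum>i<n. Q i i) = (\<Sum>i<n. P i i) + s / s"
        by (simp add: Q_def s_def sum.distrib sum_divide_distrib[symmetric] power2_eq_square)
      then show ?thesis
        using tr False by simp
    qed
    moreover have Qx: "(\<Sum>m<n. Q i m * x m) = (\<Sum>m<n. P i m * x m) + v i * (\<Sum>m<n. v m * x m) / s" for i x
      by (simp add: Q_def sum_distrib_left sum_divide_distrib sum.distrib[symmetric] algebra_simps)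
    moreover have "(\<Sum>m<n. Q i m * \<rho> r m) = \<rho> r i" if "r < k" "i < n" for r i
    proof -
      \<comment> \<open>An old vector lies in the range of \<open>P\<close>, hence is orthogonal to
        \<open>v\<close>, so the added term does not move it.\<close>
      have "(\<Sum>m<n. v m * \<rho> r m) = (\<Sum>m<n. v m * (\<Sum>l<n. P m l * \<rho> r l))"
        using fixed that by simp
      also have "\<dots> = (\<Sum>l<n. (\<Sum>m<n. v m * P m l) * \<rho> r l)"
        by (subst sum_distrib_left, subst sum.swap) (simp add: sum_distrib_right mult.assoc)
      finally show ?thesis
        using fixed that by (simp add: Qx vP)
    qed
    moreover have "(\<Sum>m<n. Q i m * \<rho> k m) = \<rho> k i" if "i < n" for i
    proof -
      \<comment> \<open>The new vector is \<open>v\<close> plus its projection, so its inner product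
        with \<open>v\<close> is \<open>s\<close>, and the added term of \<open>Q\<close> restores
        exactly \<open>v\<close>.\<close>
      have "(\<Sum>m<n. v m * \<rho> k m) = (\<Sum>m<n. v m * v m) + (\<Sum>m<n. v m * (\<Sum>l<n. P m l * \<rho> k l))"
        by (simp add: v_def[of "_ :: nat"] sum.distrib[symmetric] algebra_simps)
      also have "(\<Sum>m<n. v m * (\<Sum>l<n. P m l * \<rho> k l)) = (\<Sum>l<n. (\<Sum>m<n. v m * P m l) * \<rho> k l)"
        by (subst sum_distrib_left, subst sum.swap) (simp add: sum_distrib_right mult.assoc)
      finally have "(\<Sum>m<n. v m * \<rho> k m) = s"
        by (simp add: vP s_def power2_eq_square)
      then show ?thesis
        using False by (simp add: Qx v_def)
    qed
    ultimately show ?thesis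
      using sym by (intro exI[of _ Q]) (auto simp: less_Suc_eq Q_def mult.commute)
  qed
qed

section \<open>The operator norm of diagonal matrices\<close>

lemma vec_lp_norm_1: "vec_lp_norm 1 v = (\<Sum>i<dim_vec v. \<bar>v $ i\<bar>)"
  by (simp add: vec_lp_norm_def sum_nonneg)

text \<open>Every entry is at most the l1 norm s in absolute value, so |v_i|^p <= |v_i| s^(p-1), and
  summation gives s^p.\<close>

lemma vec_lp_norm_le_norm_1:
  assumes "1 \<le> p"
  shows "vec_lp_norm p v \<le> vec_lp_norm 1 v"
proof -
  define s where "s = (\<Sum>i<dim_vec v. \<bar>v $ i\<bar>)"
  have s: "0 \<le> s"
    by (simp add: s_def sum_nonneg)
  have le: "\<bar>v $ i\<bar> powr p \<le> \<bar>v $ i\<bar> * s powr (p - 1)" if "i < dim_vec v" for i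
  proof -
    have "\<bar>v $ i\<bar> \<le> s"
      unfolding s_def using that by (intro member_le_sum) auto
    then have "\<bar>v $ i\<bar> * \<bar>v $ i\<bar> powr (p - 1) \<le> \<bar>v $ i\<bar> * s powr (p - 1)"
      using assms by (intro mult_left_mono powr_mono2) auto
    then show ?thesis
      by (cases "v $ i = 0") (simp_all add: powr_mult_base)
  qed
  have "(\<Sum>i<dim_vec v. \<bar>v $ i\<bar> powr p) \<le> s * s powr (p - 1)"
    unfolding s_def sum_distrib_right using le by (intro sum_mono) (simp add: s_def)
  also have "\<dots> = s powr p"
    using s by (cases "s = 0") (simp_all add: powr_mult_base)
  finally have "vec_lp_norm p v \<le> (s powr p) powr (1 / p)"
    unfolding vec_lp_norm_def using assms by (intro powr_mono2) (auto intro: sum_nonneg)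
  also have "\<dots> = s"
    using s assms by (simp add: powr_powr)
  finally show ?thesis
    by (simp add: vec_lp_norm_1 s_def)
qed

lemma mat_diag_mult_vec:
  assumes "v \<in> carrier_vec n"
  shows "mat_diag n x *\<^sub>v v = vec n (\<lambda>i. x i * v $ i :: real)"
proof (rule eq_vecI)
  fix i assume "i < dim_vec (vec n (\<lambda>i. x i * v $ i))"
  then have i: "i < n" by simp
  have "(mat_diag n x *\<^sub>v v) $ i = (\<Sum>j<n. (if i = j then x j else 0) * v $ j)"
    using i assms by (auto simp: mat_diag_def scalar_prod_def atLeast0LessThan intro!: sum.cong)
  also have "\<dots> = x i * v $ i"
    using i by (simp add: if_distrib[of "\<lambda>a. a * _"] cong: if_cong)
  finally show "(mat_diag n x *\<^sub>v v) $ i = vec n (\<lambda>i. x i * v $ i) $ i"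
    using i by simp
qed (use assms in \<open>simp add: mat_diag_def\<close>)

lemma diag_ratio_le:
  assumes "1 \<le> p" "v \<in> carrier_vec n" "0 \<le> M" "\<And>i. i < n \<Longrightarrow> \<bar>x i\<bar> \<le> M"
  shows "vec_lp_norm p (mat_diag n x *\<^sub>v v) / vec_lp_norm 1 v \<le> M"
proof -
  have "vec_lp_norm p (mat_diag n x *\<^sub>v v) \<le> vec_lp_norm 1 (mat_diag n x *\<^sub>v v)"
    by (rule vec_lp_norm_le_norm_1) fact
  also have "\<dots> = (\<Sum>i<n. \<bar>x i\<bar> * \<bar>v $ i\<bar>)"
    using assms(2) by (simp add: mat_diag_mult_vec vec_lp_norm_1 abs_mult)
  also have "\<dots> \<le> (\<Sum>i<n. M * \<bar>v $ i\<bar>)"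
    using assms(4) by (intro sum_mono mult_right_mono) auto
  also have "\<dots> = M * vec_lp_norm 1 v"
    using assms(2) by (simp add: vec_lp_norm_1 sum_distrib_left)
  finally have "vec_lp_norm p (mat_diag n x *\<^sub>v v) \<le> M * vec_lp_norm 1 v" .
  moreover have "0 \<le> vec_lp_norm 1 v"
    by (simp add: vec_lp_norm_1 sum_nonneg)
  ultimately show ?thesis
    \<comment> \<open>The zero vector is allowed here; its ratio is 0 because division by zero
      yields 0.\<close>
    using assms(3) by (cases "vec_lp_norm 1 v = 0") (simp_all add: divide_le_eq)
qed

lemma unit_vec_nonzero: "j < n \<Longrightarrow> unit_vec n j \<noteq> (0\<^sub>v n :: real vec)"
  by (metis index_unit_vec(2) index_zero_vec(1) zero_neq_one)

lemma operator_lp_norm_diag_le: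
  assumes "1 \<le> p" "0 < n" "0 \<le> M" "\<And>i. i < n \<Longrightarrow> \<bar>x i\<bar> \<le> M"
  shows "operator_lp_norm 1 p (mat_diag n x) \<le> M"
proof -
  have dim: "dim_col (mat_diag n x) = n"
    by (simp add: mat_diag_def)
  have "unit_vec n 0 \<in> {v \<in> carrier_vec n. v \<noteq> (0\<^sub>v n :: real vec)}"
    using assms(2) unit_vec_nonzero by simp
  then show ?thesis
    unfolding operator_lp_norm_def dim
    by (intro cSUP_least) (blast, use assms diag_ratio_le in auto)
qed

lemma operator_lp_norm_diag_ge:
  assumes "1 \<le> p" "j < n"
  shows "\<bar>x j\<bar> \<le> operator_lp_norm 1 p (mat_diag n x)"
proof -
  have dim: "dim_col (mat_diag n x) = n"
    by (simp add: mat_diag_def)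
  have "\<bar>x i\<bar> \<le> (\<Sum>i<n. \<bar>x i\<bar>)" if "i < n" for i
    using that by (intro member_le_sum) auto
  \<comment> \<open>A real supremum is an upper bound only for a bounded set; the sum of all
    diagonal entries in absolute value is a crude bound on the ratios.\<close>
  then have bdd: "bdd_above ((\<lambda>v. vec_lp_norm p (mat_diag n x *\<^sub>v v) / vec_lp_norm 1 v) `
      {v \<in> carrier_vec n. v \<noteq> 0\<^sub>v n})"
    using assms by (intro bdd_aboveI2[where M = "\<Sum>i<n. \<bar>x i\<bar>"] diag_ratio_le) (auto simp: sum_nonneg)
  have one: "(\<Sum>i<n. \<bar>unit_vec n j $ i\<bar>) = (1::real)"
    using assms(2) by (subst sum.remove[of _ j]) (auto intro!: sum.neutral)
  have "(\<Sum>i<n. \<bar>x i * unit_vec n j $ i\<bar> powr p) = \<bar>x j\<bar> powr p"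
    using assms(2) by (subst sum.remove[of _ j]) (auto intro!: sum.neutral)
  then have "vec_lp_norm p (mat_diag n x *\<^sub>v unit_vec n j) / vec_lp_norm 1 (unit_vec n j) = \<bar>x j\<bar>"
    using assms(1) one by (simp add: mat_diag_mult_vec vec_lp_norm_1) (simp add: vec_lp_norm_def powr_powr)
  moreover have "vec_lp_norm p (mat_diag n x *\<^sub>v unit_vec n j) / vec_lp_norm 1 (unit_vec n j)
      \<le> operator_lp_norm 1 p (mat_diag n x)"
    unfolding operator_lp_norm_def dim using bdd assms(2) unit_vec_nonzero
    by (intro cSUP_upper) auto
  ultimately show ?thesis
    by simp
qed

section \<open>Sketches of diagonal matrices\<close>

definition diag_unit :: "nat \<Rightarrow> nat \<Rightarrow> real mat" where
  "diag_unit n j = mat_diag n (\<lambda>i. if i = j then 1 else 0)"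

lemma diag_unit_carrier [simp]: "diag_unit n j \<in> carrier_mat n n"
  by (simp add: diag_unit_def)

text \<open>On diagonal matrices each output coordinate is a linear functional with coefficients
  \<open>L (diag_unit n j) $ r\<close>. The induction switches the diagonal entries on one at a
  time.\<close>

lemma linear_sketch_diag:
  assumes L: "linear_sketch n k L" and r: "r < k"
  shows "L (mat_diag n x) $ r = (\<Sum>j<n. x j * L (diag_unit n j) $ r)"
proof -
  have carr: "A \<in> carrier_mat n n \<Longrightarrow> L A \<in> carrier_vec k"
    and add: "A \<in> carrier_mat n n \<Longrightarrow> B \<in> carrier_mat n n \<Longrightarrow> L (A + B) = L A + L B"
    and smult: "A \<in> carrier_mat n n \<Longrightarrow> L (c \<cdot>\<^sub>m A) = c \<cdot>\<^sub>v L A" for A B c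
    using L by (auto simp: linear_sketch_def)
  have "L (mat_diag n (\<lambda>i. if i < m then x i else 0)) $ r = (\<Sum>j<m. x j * L (diag_unit n j) $ r)" for m
  proof (induction m)
    case 0
    \<comment> \<open>That \<open>L\<close> maps the zero matrix to zero comes from homogeneity with
      scalar 0.\<close>
    have "mat_diag n (\<lambda>i. if i < 0 then x i else 0) = 0 \<cdot>\<^sub>m diag_unit n 0"
      by (auto simp: mat_diag_def diag_unit_def)
    then show ?case
      using r carr[of "diag_unit n 0"] by (simp add: smult carrier_vecD)
  next
    case (Suc m)
    let ?A = "mat_diag n (\<lambda>i. if i < m then x i else 0)"
    have "mat_diag n (\<lambda>i. if i < Suc m then x i else 0) = ?A + x m \<cdot>\<^sub>m diag_unit n m"
      by (auto simp: mat_diag_def diag_unit_def less_Suc_eq)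
    then have "L (mat_diag n (\<lambda>i. if i < Suc m then x i else 0)) = L ?A + x m \<cdot>\<^sub>v L (diag_unit n m)"
      by (simp add: add smult)
    then show ?case
      using Suc r carr[of "diag_unit n m"] by (simp add: carrier_vecD)
  qed
  moreover have "mat_diag n (\<lambda>i. if i < n then x i else 0) = mat_diag n x"
    by (rule eq_matI) (auto simp: mat_diag_def)
  ultimately show ?thesis
    by metis
qed

section \<open>Measurability of the sketch jointly in the map and the matrix\<close>

lemma measurable_vec_borel_coord:
  assumes "i < k"
  shows "(\<lambda>v. v $ i) \<in> borel_measurable (vec_borel k)"
proof -
  have "(\<lambda>v. \<lambda>i\<in>{..<k}. v $ i) \<in> vec_borel k \<rightarrow>\<^sub>M (\<Pi>\<^sub>M i\<in>{..<k}. borel :: real measure)"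
    unfolding vec_borel_def by (rule measurable_vimage_algebra1) (auto simp: space_PiM)
  then have "(\<lambda>v. (\<lambda>i\<in>{..<k}. v $ i) i) \<in> borel_measurable (vec_borel k)"
    by (rule measurable_compose[OF _ measurable_component_singleton]) (use assms in simp)
  then show ?thesis
    using assms by simp
qed

lemma measurable_vec_borelI:
  assumes "\<And>\<omega>. \<omega> \<in> space M \<Longrightarrow> X \<omega> \<in> carrier_vec k"
    and "\<And>i. i < k \<Longrightarrow> (\<lambda>\<omega>. X \<omega> $ i) \<in> borel_measurable M"
  shows "X \<in> M \<rightarrow>\<^sub>M vec_borel k"
  unfolding vec_borel_def using assms
  by (intro measurable_vimage_algebra2 measurable_restrict) auto

text \<open>Only evaluations at fixed matrices are known to be measurable in \<open>L\<close>. On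
  diagonal matrices the \<open>n\<close> evaluations at \<open>diag_unit n j\<close> determine the
  sketch linearly, which makes it jointly measurable.\<close>

lemma measurable_sketch_diag:
  assumes L: "\<And>L. L \<in> space S \<Longrightarrow> linear_sketch n k L"
    and eval: "\<And>A. A \<in> carrier_mat n n \<Longrightarrow> (\<lambda>L. L A) \<in> S \<rightarrow>\<^sub>M vec_borel k"
    and h: "\<And>i. i < n \<Longrightarrow> (\<lambda>x. h x i) \<in> borel_measurable N"
  shows "(\<lambda>(L, x). L (mat_diag n (h x))) \<in> S \<Otimes>\<^sub>M N \<rightarrow>\<^sub>M vec_borel k"
proof (rule measurable_vec_borelI)
  fix \<omega> assume "\<omega> \<in> space (S \<Otimes>\<^sub>M N)"
  then have "linear_sketch n k (fst \<omega>)"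
    using L by (auto simp: space_pair_measure)
  then show "(case \<omega> of (L, x) \<Rightarrow> L (mat_diag n (h x))) \<in> carrier_vec k"
    by (auto simp: linear_sketch_def split: prod.split)
next
  fix r assume r: "r < k"
  have [measurable]: "(\<lambda>\<omega>. fst \<omega> (diag_unit n j) $ r) \<in> borel_measurable (S \<Otimes>\<^sub>M N)" for j
    by (rule measurable_compose[OF measurable_fst
          measurable_compose[OF eval[OF diag_unit_carrier] measurable_vec_borel_coord[OF r]]])
  have "(\<lambda>\<omega>. \<Sum>j<n. h (snd \<omega>) j * fst \<omega> (diag_unit n j) $ r) \<in> borel_measurable (S \<Otimes>\<^sub>M N)"
  proof (rule borel_measurable_sum, rule borel_measurable_times)
    fix j assume "j \<in> {..<n}"
    then show "(\<lambda>\<omega>. h (snd \<omega>) j) \<in> borel_measurable (S \<Otimes>\<^sub>M N)"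
      using measurable_compose[OF measurable_snd h] by simp
  qed measurable
  moreover have "(case \<omega> of (L, x) \<Rightarrow> L (mat_diag n (h x))) $ r = (\<Sum>j<n. h (snd \<omega>) j * fst \<omega> (diag_unit n j) $ r)"
    if "\<omega> \<in> space (S \<Otimes>\<^sub>M N)" for \<omega>
    using that linear_sketch_diag[OF L r] by (auto simp: space_pair_measure)
  ultimately show "(\<lambda>\<omega>. (case \<omega> of (L, x) \<Rightarrow> L (mat_diag n (h x))) $ r) \<in> borel_measurable (S \<Otimes>\<^sub>M N)"
    by (simp cong: measurable_cong)
qed

section \<open>The lower bound\<close>

text \<open>Fubini: a success probability over random maps, guaranteed for almost every input,
  becomes an average over maps of the success probability on random inputs.\<close>

lemma (in pair_prob_space) integral_measure_section_ge:
  assumes A: "{\<omega> \<in> space (M1 \<Otimes>\<^sub>M M2). Q (fst \<omega>) (snd \<omega>)} \<in> sets (M1 \<Otimes>\<^sub>M M2)"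
    and ge: "AE y in M2. measure M1 {x \<in> space M1. Q x y} \<ge> q"
  shows "integrable M1 (\<lambda>x. measure M2 {y \<in> space M2. Q x y})"
    and "q \<le> (\<integral>x. measure M2 {y \<in> space M2. Q x y} \<partial>M1)"
proof -
  let ?A = "{\<omega> \<in> space (M1 \<Otimes>\<^sub>M M2). Q (fst \<omega>) (snd \<omega>)}"
  have int: "integrable (M1 \<Otimes>\<^sub>M M2) (indicator ?A :: _ \<Rightarrow> real)"
    using A by (simp add: integrable_indicator_iff emeasure_eq_measure less_top[symmetric])
  then have int2: "integrable (M1 \<Otimes>\<^sub>M M2) (case_prod (\<lambda>x y. indicator ?A (x, y) :: real))"
    by simp
  have sec2: "(\<integral>y. indicator ?A (x, y) \<partial>M2) = measure M2 {y \<in> space M2. Q x y}" if "x \<in> space M1" for x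
  proof -
    have "(\<integral>y. indicator ?A (x, y) \<partial>M2) = (\<integral>y. indicator {y \<in> space M2. Q x y} y \<partial>M2)"
      using that by (intro Bochner_Integration.integral_cong) (auto simp: space_pair_measure indicator_def)
    also have "\<dots> = measure M2 ({y \<in> space M2. Q x y} \<inter> space M2)"
      by (rule Bochner_Integration.integral_indicator)
    finally show ?thesis
      by (simp add: Int_absorb2 subset_iff)
  qed
  have sec1: "(\<integral>x. indicator ?A (x, y) \<partial>M1) = measure M1 {x \<in> space M1. Q x y}" if "y \<in> space M2" for y
  proof -
    have "(\<integral>x. indicator ?A (x, y) \<partial>M1) = (\<integral>x. indicator {x \<in> space M1. Q x y} x \<partial>M1)"
      using that by (intro Bochner_Integration.integral_cong) (auto simp: space_pair_measure indicator_def)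
    also have "\<dots> = measure M1 ({x \<in> space M1. Q x y} \<inter> space M1)"
      by (rule Bochner_Integration.integral_indicator)
    finally show ?thesis
      by (simp add: Int_absorb2 subset_iff)
  qed
  have "integrable M1 (\<lambda>x. \<integral>y. (indicator ?A (x, y) :: real) \<partial>M2)"
    by (rule integrable_fst'[OF int])
  then show "integrable M1 (\<lambda>x. measure M2 {y \<in> space M2. Q x y})"
    by (simp add: sec2 cong: Bochner_Integration.integrable_cong)
  have int1: "integrable M2 (\<lambda>y. measure M1 {x \<in> space M1. Q x y})"
    using integrable_snd[OF int2]
    by (simp add: sec1 cong: Bochner_Integration.integrable_cong)
  have "q = (\<integral>y. q \<partial>M2)"
    by (simp add: M2.prob_space)
  also have "\<dots> \<le> (\<integral>y. measure M1 {x \<in> space M1. Q x y} \<partial>M2)"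
    using int1 ge by (intro integral_mono_AE) auto
  also have "\<dots> = (\<integral>y. (\<integral>x. indicator ?A (x, y) \<partial>M1) \<partial>M2)"
    by (intro Bochner_Integration.integral_cong) (auto simp: sec1)
  also have "\<dots> = (\<integral>x. (\<integral>y. indicator ?A (x, y) \<partial>M2) \<partial>M1)"
    by (rule Fubini_integral) (rule int2)
  also have "\<dots> = (\<integral>x. measure M2 {y \<in> space M2. Q x y} \<partial>M1)"
    by (intro Bochner_Integration.integral_cong) (auto simp: sec2)
  finally show "q \<le> (\<integral>x. measure M2 {y \<in> space M2. Q x y} \<partial>M1)" .
qed

text \<open>If every row functional of \<open>L\<close> takes the same value on \<open>w\<close> as
  on the unit vector e_j, then \<open>L\<close> cannot tell a shift by c w from one by c e_j. The
  left side is restricted to match the shifts in \<open>noise_test\<close>.\<close>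

lemma sketch_shift_eq:
  assumes L: "linear_sketch n k L" and j: "j < n"
    and fixed: "\<And>r. r < k \<Longrightarrow> (\<Sum>m<n. w m * L (diag_unit n m) $ r) = L (diag_unit n j) $ r"
  shows "L (mat_diag n (\<lambda>i\<in>{..<n}. x i + c * w i)) = L (mat_diag n (\<lambda>i. x i + (if i = j then c else 0)))"
proof (rule eq_vecI)
  have carr: "A \<in> carrier_mat n n \<Longrightarrow> L A \<in> carrier_vec k" for A
    using L by (simp add: linear_sketch_def)
  then show "dim_vec (L (mat_diag n (\<lambda>i\<in>{..<n}. x i + c * w i)))
      = dim_vec (L (mat_diag n (\<lambda>i. x i + (if i = j then c else 0))))"
    by (metis carrier_vecD mat_diag_dim)
  fix r assume "r < dim_vec (L (mat_diag n (\<lambda>i. x i + (if i = j then c else 0))))"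
  then have r: "r < k"
    by (metis carr carrier_vecD mat_diag_dim)
  let ?\<rho> = "\<lambda>m. L (diag_unit n m) $ r"
  have "L (mat_diag n (\<lambda>i\<in>{..<n}. x i + c * w i)) $ r = (\<Sum>m<n. x m * ?\<rho> m) + c * (\<Sum>m<n. w m * ?\<rho> m)"
    by (simp add: linear_sketch_diag[OF L r] distrib_right sum.distrib sum_distrib_left mult.assoc)
  also have "\<dots> = (\<Sum>m<n. x m * ?\<rho> m) + (\<Sum>m<n. (if m = j then c else 0) * ?\<rho> m)"
    using fixed[OF r] j by (simp add: if_distrib[of "\<lambda>a. a * _"] cong: if_cong)
  also have "\<dots> = L (mat_diag n (\<lambda>i. x i + (if i = j then c else 0))) $ r"
    by (simp add: linear_sketch_diag[OF L r] distrib_right sum.distrib)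
  finally show "L (mat_diag n (\<lambda>i\<in>{..<n}. x i + c * w i)) $ r
      = L (mat_diag n (\<lambda>i. x i + (if i = j then c else 0))) $ r" .
qed

text \<open>For a fixed map, e_j is replaced by row \<open>j\<close> of the projection
  \<open>P\<close> onto the row space. By symmetry and idempotence that row has squared length
  \<open>P j j\<close>, and these add up to the trace, which is at most \<open>k\<close>.\<close>

lemma sum_noise_tests_le:
  assumes L: "linear_sketch n k L"
    and T: "Measurable.pred (lborel_n n) (\<lambda>x. T (L (mat_diag n x)))"
  shows "(\<Sum>j<n. measure (noise n) {x \<in> space (lborel_n n). T (L (mat_diag n x))}
        + measure (noise n) {x \<in> space (lborel_n n). \<not> T (L (mat_diag n (\<lambda>i. x i + (if i = j then c else 0))))})
      \<le> 3 / 2 * real n + 30 * c\<^sup>2 * real k"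
proof -
  obtain P :: "nat \<Rightarrow> nat \<Rightarrow> real" where sym: "\<And>i j. P i j = P j i"
    and idem: "\<And>i j. (\<Sum>m<n. P i m * P m j) = P i j"
    and tr: "(\<Sum>i<n. P i i) \<le> real k"
    and fixed: "\<And>r i. r < k \<Longrightarrow> i < n \<Longrightarrow> (\<Sum>m<n. P i m * L (diag_unit n m) $ r) = L (diag_unit n i) $ r"
    using exists_projection_fixing[of n k "\<lambda>r j. L (diag_unit n j) $ r"] by blast
  have "measure (noise n) {x \<in> space (lborel_n n). T (L (mat_diag n x))}
        + measure (noise n) {x \<in> space (lborel_n n). \<not> T (L (mat_diag n (\<lambda>i. x i + (if i = j then c else 0))))}
      \<le> 3 / 2 + 30 * c\<^sup>2 * P j j" if j: "j < n" for j
  proof -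
    have "(\<Sum>i<n. (c * P j i)\<^sup>2) = c\<^sup>2 * (\<Sum>i<n. P j i * P i j)"
      by (simp add: sum_distrib_left power_mult_distrib power2_eq_square sym[of _ j] mult_ac)
    then show ?thesis
      using noise_test[OF T, of "\<lambda>i. c * P j i"] j
      by (simp add: sketch_shift_eq[where w = "P j", OF L j fixed[OF _ j]] idem)
  qed
  then have "(\<Sum>j<n. measure (noise n) {x \<in> space (lborel_n n). T (L (mat_diag n x))}
        + measure (noise n) {x \<in> space (lborel_n n). \<not> T (L (mat_diag n (\<lambda>i. x i + (if i = j then c else 0))))})
      \<le> (\<Sum>j<n. 3 / 2 + 30 * c\<^sup>2 * P j j)"
    by (intro sum_mono) auto
  also have "\<dots> = 3 / 2 * real n + 30 * c\<^sup>2 * (\<Sum>j<n. P j j)"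
    by (simp add: sum.distrib sum_distrib_left)
  also have "\<dots> \<le> 3 / 2 * real n + 30 * c\<^sup>2 * real k"
    using tr by (intro add_left_mono mult_left_mono) auto
  finally show ?thesis .
qed

lemma sketching_family_dim_ge:
  assumes \<kappa>: "1 < \<kappa>" and p: "1 \<le> p" and n: "0 < n"
    and fam: "sketching_family n 1 p k (sqrt \<kappa>) S f"
  shows "real n \<le> 180 * \<kappa>\<^sup>2 * real k"
proof -
  interpret S: prob_space S
    using fam by (simp add: sketching_family_def)
  interpret D: prob_space "noise n"
    by (rule prob_space_noise)
  interpret pair_prob_space S "noise n" ..
  have lin: "linear_sketch n k L" if "L \<in> space S" for L
    using fam that by (simp add: sketching_family_def)
  have eval: "(\<lambda>L. L A) \<in> S \<rightarrow>\<^sub>M vec_borel k" if "A \<in> carrier_mat n n" for A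
    using fam that by (simp add: sketching_family_def)
  have f: "f \<in> borel_measurable (vec_borel k)"
    using fam by (simp add: sketching_family_def)
  \<comment> \<open>Weakens the two-sided guarantee to any measurable property of the estimate
    implied by it; it is used for the threshold test and for its negation.\<close>
  have succ: "5 / 6 \<le> S.prob {L \<in> space S. Q (f (L A))}"
    if A: "A \<in> carrier_mat n n" "A \<noteq> 0\<^sub>m n n" and Q: "Measurable.pred borel Q"
      and imp: "\<And>y. 1 / sqrt \<kappa> * operator_lp_norm 1 p A < y \<Longrightarrow> y < sqrt \<kappa> * operator_lp_norm 1 p A \<Longrightarrow> Q y"
    for A Q
  proof -
    have "5 / 6 \<le> S.prob {L \<in> space S.
        f (L A) \<in> {1 / sqrt \<kappa> * operator_lp_norm 1 p A <..< sqrt \<kappa> * operator_lp_norm 1 p A}}"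
      using fam A by (simp add: sketching_family_def)
    also have "\<dots> \<le> S.prob {L \<in> space S. Q (f (L A))}"
    proof (rule S.finite_measure_mono)
      have [measurable]: "(\<lambda>L. f (L A)) \<in> borel_measurable S"
        using measurable_compose[OF eval[OF A(1)] f] .
      note [measurable] = Q
      show "{L \<in> space S. Q (f (L A))} \<in> sets S"
        by measurable
    qed (use imp in auto)
    finally show ?thesis .
  qed
  \<comment> \<open>With shift \<kappa> the two guaranteed intervals are separated by sqrt \<kappa>:
    the unshifted one ends at or below it, and the shifted one starts at or above \<kappa> / sqrt
    \<kappa>, the same number.\<close>
  let ?e = "\<lambda>j (x :: nat \<Rightarrow> real) i. x i + (if i = j then \<kappa> else 0)"
  let ?T = "\<lambda>L x. f (L (mat_diag n x)) < sqrt \<kappa>"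
  have meas: "(\<lambda>\<omega>. f (fst \<omega> (mat_diag n (h (snd \<omega>))))) \<in> borel_measurable (S \<Otimes>\<^sub>M noise n)"
    if "\<And>i. i < n \<Longrightarrow> (\<lambda>x. h x i) \<in> borel_measurable (noise n)" for h :: "(nat \<Rightarrow> real) \<Rightarrow> nat \<Rightarrow> real"
    using measurable_compose[OF measurable_sketch_diag[OF lin eval that] f]
    by (simp add: case_prod_unfold)
  have proj: "(\<lambda>x. x i) \<in> borel_measurable (noise n)" if "i < n" for i
    using that unfolding noise_def by simp
  have measA [measurable]: "(\<lambda>\<omega>. f (fst \<omega> (mat_diag n (snd \<omega>)))) \<in> borel_measurable (S \<Otimes>\<^sub>M noise n)"
    by (rule meas) (rule proj)
  have measB [measurable]: "(\<lambda>\<omega>. f (fst \<omega> (mat_diag n (?e j (snd \<omega>))))) \<in> borel_measurable (S \<Otimes>\<^sub>M noise n)" for j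
    by (rule meas) (intro borel_measurable_add proj borel_measurable_const)
  have entry: "mat_diag n x \<noteq> 0\<^sub>m n n" if "i < n" "x i \<noteq> (0::real)" for x i
  proof
    assume "mat_diag n x = 0\<^sub>m n n"
    then have "mat_diag n x $$ (i, i) = 0\<^sub>m n n $$ (i, i)"
      by simp
    then show False
      using that by (simp add: mat_diag_def)
  qed
  have "S.prob {L \<in> space S. ?T L x} \<ge> 5 / 6" if x: "\<forall>i<n. x i \<in> {0<..<1}" for x
  proof (rule succ)
    have "operator_lp_norm 1 p (mat_diag n x) \<le> 1"
      using x n p by (intro operator_lp_norm_diag_le) auto
    then have "sqrt \<kappa> * operator_lp_norm 1 p (mat_diag n x) \<le> sqrt \<kappa>"
      using \<kappa> by (simp add: mult_le_cancel_left1)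
    then show "y < sqrt \<kappa>" if "y < sqrt \<kappa> * operator_lp_norm 1 p (mat_diag n x)" for y
      using that by simp
    \<comment> \<open>The guarantee concerns nonzero matrices only; the cube is open, so the entry
      at index 0 is positive.\<close>
    show "mat_diag n x \<noteq> 0\<^sub>m n n"
      using entry[of 0 x] n x by force
  qed auto
  then have "AE x in noise n. S.prob {L \<in> space S. ?T L x} \<ge> 5 / 6"
    by (rule eventually_mono[OF AE_noise])
  from integral_measure_section_ge[OF _ this]
  have A: "integrable S (\<lambda>L. D.prob {x \<in> space (noise n). ?T L x})"
    "5 / 6 \<le> (\<integral>L. D.prob {x \<in> space (noise n). ?T L x} \<partial>S)"
    by measurable
  have "S.prob {L \<in> space S. \<not> ?T L (?e j x)} \<ge> 5 / 6" if x: "\<forall>i<n. x i \<in> {0<..<1}" and j: "j < n" for x j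
  proof (rule succ)
    have xj: "0 < x j"
      using x j by simp
    have "\<kappa> \<le> operator_lp_norm 1 p (mat_diag n (?e j x))"
      using operator_lp_norm_diag_ge[OF p j, of "?e j x"] xj \<kappa> by simp
    then have "1 / sqrt \<kappa> * \<kappa> \<le> 1 / sqrt \<kappa> * operator_lp_norm 1 p (mat_diag n (?e j x))"
      using \<kappa> by (intro mult_left_mono) auto
    then have "sqrt \<kappa> \<le> 1 / sqrt \<kappa> * operator_lp_norm 1 p (mat_diag n (?e j x))"
      using \<kappa> by (simp add: real_div_sqrt)
    then show "\<not> y < sqrt \<kappa>" if "1 / sqrt \<kappa> * operator_lp_norm 1 p (mat_diag n (?e j x)) < y" for y
      using that by simp
    show "mat_diag n (?e j x) \<noteq> 0\<^sub>m n n"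
      using entry[of j "?e j x"] j xj \<kappa> by simp
  qed auto
  then have "AE x in noise n. S.prob {L \<in> space S. \<not> ?T L (?e j x)} \<ge> 5 / 6" if "j < n" for j
    using that by (intro eventually_mono[OF AE_noise]) auto
  from integral_measure_section_ge[OF _ this]
  have B: "integrable S (\<lambda>L. D.prob {x \<in> space (noise n). \<not> ?T L (?e j x)})"
    "5 / 6 \<le> (\<integral>L. D.prob {x \<in> space (noise n). \<not> ?T L (?e j x)} \<partial>S)" if "j < n" for j
    using that by measurable
  have bound: "(\<Sum>j<n. D.prob {x \<in> space (noise n). ?T L x} + D.prob {x \<in> space (noise n). \<not> ?T L (?e j x)})
      \<le> 3 / 2 * real n + 30 * \<kappa>\<^sup>2 * real k" if L: "L \<in> space S" for L
  proof -
    have [measurable]: "(\<lambda>x. f (L (mat_diag n x))) \<in> borel_measurable (lborel_n n)"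
      using measurable_compose[OF measurable_Pair1'[OF L] measA] by (simp cong: measurable_cong_sets)
    have "Measurable.pred (lborel_n n) (\<lambda>x. f (L (mat_diag n x)) < sqrt \<kappa>)"
      by measurable
    from sum_noise_tests_le[OF lin[OF L], of "\<lambda>y. f y < sqrt \<kappa>", OF this, of \<kappa>]
    show ?thesis
      by simp
  qed
  \<comment> \<open>The guarantees for the unshifted and the shifted matrix are added for each
    \<open>j\<close>. After exchanging sum and integral, \<open>bound\<close> applies to every
    single map.\<close>
  have "5 / 3 * real n = (\<Sum>j<n. 5 / 6 + 5 / 6)"
    by simp
  also have "\<dots> \<le> (\<Sum>j<n. (\<integral>L. D.prob {x \<in> space (noise n). ?T L x} \<partial>S)
      + (\<integral>L. D.prob {x \<in> space (noise n). \<not> ?T L (?e j x)} \<partial>S))"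
    using A(2) B(2) by (intro sum_mono add_mono) auto
  also have "\<dots> = (\<integral>L. (\<Sum>j<n. D.prob {x \<in> space (noise n). ?T L x}
      + D.prob {x \<in> space (noise n). \<not> ?T L (?e j x)}) \<partial>S)"
    using A(1) B(1) by (subst Bochner_Integration.integral_sum) (auto intro!: sum.cong)
  also have "\<dots> \<le> (\<integral>L. 3 / 2 * real n + 30 * \<kappa>\<^sup>2 * real k \<partial>S)"
    using A(1) B(1) bound
    by (intro integral_mono Bochner_Integration.integrable_sum Bochner_Integration.integrable_add) auto
  also have "\<dots> = 3 / 2 * real n + 30 * \<kappa>\<^sup>2 * real k"
    by (simp add: S.prob_space)
  \<comment> \<open>The gap 5/3 - 3/2 = 1/6 leaves n / 6 <= 30 \<kappa>^2 k, whence the constant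
    180.\<close>
  finally show ?thesis
    by simp
qed

theorem theorem4p4:
  fixes \<kappa> :: real
  assumes "\<kappa> > 1"
  shows "\<exists>c > 0. \<forall>\<^sub>F n in sequentially. \<forall>p \<in> {1..2}. \<forall>k S f.
           sketching_family n 1 p k (sqrt \<kappa>) S f \<longrightarrow> real k \<ge> c * real n"
\<comment> \<open>The witness inverts the constant of \<open>sketching_family_dim_ge\<close>; it
  depends on \<kappa> alone, and the bound holds from n = 1 on.\<close>
proof (intro exI[of _ "1 / (180 * \<kappa>\<^sup>2)"] conjI)
  show "0 < 1 / (180 * \<kappa>\<^sup>2)"
    using assms by simp
  show "\<forall>\<^sub>F n in sequentially. \<forall>p \<in> {1..2}. \<forall>k S f.
      sketching_family n 1 p k (sqrt \<kappa>) S f \<longrightarrow> real k \<ge> 1 / (180 * \<kappa>\<^sup>2) * real n"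
    using eventually_gt_at_top[of 0]
  proof eventually_elim
    case (elim n)
    show ?case
    proof (intro ballI allI impI)
      fix p k S f
      assume "p \<in> {1..2::real}" "sketching_family n 1 p k (sqrt \<kappa>) S f"
      then have "real n \<le> 180 * \<kappa>\<^sup>2 * real k"
        using assms elim by (intro sketching_family_dim_ge) auto
      then show "real k \<ge> 1 / (180 * \<kappa>\<^sup>2) * real n"
        using assms by (simp add: divide_le_eq mult.commute)
    qed
  qed
qed

end
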